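(* Let $L\ge m>0$, let $f\in S(m,L)$ be a function on $\mathbb{R}^d$, and let $\Omega\subseteq\mathbb{R}^d$ be a nonempty closed convex set. Consider a first-order algorithm in the transformed form $(\tilde A,\tilde B,\tilde C)$, a filter $\Psi$, and the augmented matrices $(\hat A,\hat B,\hat C,\hat D)$ as described in the context. Suppose that Assumption A ($C_1=c_1I_d\prec 0$) and Assumption B (existence of $M$, $\rho\in(0,1)$ and $\mathbf{P}=\mathbf{P}^\top\succ0$ with the truncated hard IQC and the LMI) hold, and let $\mathcal{D}=\Omega\times\mathbb{R}^{(n+p-1)d}$. Then there exists a unique fixed point $(u_*,y_*,x_* )$ of the projected algorithm $$x_{k+\frac12}=\hat A x_k+\hat B u_k,\qquad u_k=\nabla f(y_k),\qquad y_k=x_k^{(1)},\qquad x_{k+1}=\Pi^{\mathbf{P}}_{\mathcal{D}}\big(x_{k+\frac12}\big),$$ i.e. a unique triple with $x_*=\Pi^{\mathbf{P}}_{\mathcal{D}}(\hat A x_*+\hat B u_* )$, $u_*=\nabla f(y_* )$, $y_*=x_*^{(1)}$; and $y_*$ is the optimal solution of the problem $\text{minimize}_{y\in\Omega} f(y)$.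
   Context: **Function class.** $S(m,L)$ is the set of differentiable $f:\mathbb{R}^d\to\mathbb{R}$ with $m\|x-y\|_2^2\le(\nabla f(x)-\nabla f(y))^\top(x-y)\le L\|x-y\|_2^2$ for all $x,y\in\mathbb{R}^d$ (differentiable, $m$-strongly convex and $L$-Lipschitz smooth). **Weighted projection.** For $P\succ0$ and a nonempty closed convex set $\mathcal{D}$, $\|x\|_P=\sqrt{x^\top Px}$ and $\Pi^P_{\mathcal{D}}(x)=\operatorname{argmin}_{z\in\mathcal{D}}\|z-x\|_P^2$. **Algorithm.** Let $n>1$. The unconstrained first-order algorithm has state $\xi_k=(\xi^{(1)}_k,\xi^{(2)}_k)\in\mathbb{R}^d\times\mathbb{R}^{(n-1)d}$ and is $$\xi^{(1)}_{k+1}=\xi^{(1)}_k+u_k,\quad \xi^{(2)}_{k+1}=A_{21}\xi^{(1)}_k+A_{22}\xi^{(2)}_k,\quad y_k=C_1\xi^{(1)}_k+C_2\xi^{(2)}_k,\quad u_k=\nabla f(y_k).$$ All matrices are of the form $(\cdot)\otimes I_d$; in particular $C_1=c_1I_d$ with $c_1\in\mathbb{R}$. *Assumption A:* $C_1=c_1I_d\prec0$, i.e. $c_1<0$. With $\tilde\xi_k=\begin{bmatrix} C_1 & C_2 \\ 0 & I \end{bmatrix}\xi_k=(y_k,\xi_k^{(2)})$ the system becomes $\tilde\xi_{k+1}=\tilde A\tilde\xi_k+\tilde Bu_k$, $y_k=\tilde C\tilde\xi_k$, where $$\tilde A=\begin{bmatrix} C_1 & C_2 \\ 0 & I \end{bmatrix}\begin{bmatrix}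 I_d & 0 \\ A_{21} & A_{22} \end{bmatrix}\begin{bmatrix} C_1 & C_2 \\ 0 & I \end{bmatrix}^{-1},\quad \tilde B=\begin{bmatrix} C_1 \\ 0 \end{bmatrix},\quad \tilde C=\begin{bmatrix} I_d & 0 \end{bmatrix},\quad \tilde D=0.$$ **Filter.** $\Psi$ is a stable linear system ($A_\Psi$ Schur stable, all matrices of the form $(\cdot)\otimes I_d$) with state $\zeta_k\in\mathbb{R}^{pd}$ and output $h_k\in\mathbb{R}^{qd}$: $$\zeta_{k+1}=A_\Psi\zeta_k+B^y_\Psi y_k+B^u_\Psi u_k,\quad h_k=C_\Psi\zeta_k+D^y_\Psi y_k+D^u_\Psi u_k .$$ For each $(y_*,u_* )$, $(\zeta_*,h_* )$ denotes its unique fixed point under the constant input $(y_*,u_* )$. **Truncated hard IQC for symmetric $M\in\mathbb{R}^{qd\times qd}$.** For every $f\in S(m,L)$, every $\zeta_0\in\mathbb{R}^{pd}$, every sequence $(y_k)$ in $\mathbb{R}^d$ with $u_k=\nabla f(y_k)$, every $y_*\in\mathbb{R}^d$ with $u_*=\nabla f(y_* )$, and all integers $T\ge t\ge0$: $\sum_{k=t}^{T}(h_k-h_* )^\top M(h_k-h_* )\ge0$. **Augmented system.** State $x_k=(\tilde\xi_k,\zeta_k)\in\mathbb{R}^{(n+p)d}$, with $x^{(1)}\in\mathbb{R}^d$ its first block (equal to $y$) and $$\hat A=\begin{bmatrix} \tilde A & 0 \\ B^y_\Psi\tilde C & A_\Psi \end{bmatrix},\quad\hat B=\begin{bmatrix}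 \tilde B \\ B^u_\Psi \end{bmatrix},\quad\hat C=\begin{bmatrix} D^y_\Psi\tilde C & C_\Psi \end{bmatrix},\quad\hat D=D^u_\Psi .$$ *Assumption B:* there exist a symmetric $M$ satisfying the truncated hard IQC, $\rho\in(0,1)$, and $\mathbf{P}=\mathbf{P}^\top\succ0$ such that $$\begin{bmatrix} \hat A^\top\mathbf{P}\hat A-\rho^2\mathbf{P} & \hat A^\top\mathbf{P}\hat B \\ \hat B^\top\mathbf{P}\hat A & \hat B^\top\mathbf{P}\hat B \end{bmatrix}+\begin{bmatrix} \hat C^\top \\ \hat D^\top \end{bmatrix}M\begin{bmatrix} \hat C & \hat D \end{bmatrix}\preceq0,$$ and $\mathbf{P}$ has the Kronecker form $\mathbf{P}=P\otimes I_d$ with $P\in\mathbb{R}^{(n+p)\times(n+p)}$. *)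

theory Defs
  imports "HOL-Analysis.Analysis"
begin

text \<open>
  A vector of $\mathbb{R}^{nd}$, viewed as $n$ blocks of size $d$, has type
  \<open>real ^ ('n \<times> 'd)\<close>: the first component of an index selects the block, the second the
  coordinate inside the block.  Since all system matrices have the form $A \otimes I_d$, they are
  given by their first factor \<open>A\<close>, block matrices are formed on the level of these factors, and
  \<open>kronI\<close> is applied to the result.  The index type \<open>1\<close> stands for a single block.
\<close>

definition kron :: "real^'n^'m \<Rightarrow> real^'b^'a \<Rightarrow> real^('n \<times> 'b)^('m \<times> 'a)" where
  "kron A B = (\<chi> i j. A $ fst i $ fst j * B $ snd i $ snd j)"

definition kronI :: "real^'n^'m \<Rightarrow> real^('n \<times> 'd::finite)^('m \<times> 'd)" where
  "kronI A = kron A (mat 1)"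

definition single :: "real^'d \<Rightarrow> real^(1 \<times> 'd)" where
  "single v = (\<chi> i. v $ snd i)"

definition block :: "'n::finite \<Rightarrow> real^('n \<times> 'd::finite) \<Rightarrow> real^'d" where
  "block i x = (\<chi> a. x $ (i, a))"

definition hcat :: "real^'n^'m \<Rightarrow> real^'k^'m \<Rightarrow> real^('n + 'k)^'m" where
  "hcat A B = (\<chi> i j. case j of Inl c \<Rightarrow> A $ i $ c | Inr c \<Rightarrow> B $ i $ c)"

definition vcat :: "real^'n^'m \<Rightarrow> real^'n^'l \<Rightarrow> real^'n^('m + 'l)" where
  "vcat A B = (\<chi> i. case i of Inl r \<Rightarrow> A $ r | Inr r \<Rightarrow> B $ r)"

definition four_block ::
  "real^'n^'m \<Rightarrow> real^'k^'m \<Rightarrow> real^'n^'l \<Rightarrow> real^'k^'l \<Rightarrow> real^('n + 'k)^('m + 'l)" where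
  "four_block A B C D = vcat (hcat A B) (hcat C D)"

definition pos_def :: "real^'n^'n \<Rightarrow> bool" where
  "pos_def P \<longleftrightarrow> transpose P = P \<and> (\<forall>v. v \<noteq> 0 \<longrightarrow> 0 < v \<bullet> (P *v v))"

definition neg_semidef :: "real^'n^'n \<Rightarrow> bool" where
  "neg_semidef N \<longleftrightarrow> transpose N = N \<and> (\<forall>v. v \<bullet> (N *v v) \<le> 0)"

definition schur_stable :: "real^'n^'n \<Rightarrow> bool" where
  "schur_stable A \<longleftrightarrow>
     (\<forall>(z::complex) (v::complex^'n). v \<noteq> 0 \<and> map_matrix complex_of_real A *v v = z *s v
        \<longrightarrow> cmod z < 1)"


definition grad :: "('a::real_inner \<Rightarrow> real) \<Rightarrow> 'a \<Rightarrow> 'a" where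
  "grad f x = (THE g. GDERIV f x :> g)"

definition S_class :: "real \<Rightarrow> real \<Rightarrow> (real^'d \<Rightarrow> real) set" where
  "S_class m L = {f. (\<forall>x. f differentiable at x) \<and>
     (\<forall>x y. m * (norm (x - y))\<^sup>2 \<le> (grad f x - grad f y) \<bullet> (x - y) \<and>
            (grad f x - grad f y) \<bullet> (x - y) \<le> L * (norm (x - y))\<^sup>2)}"

definition wnorm :: "real^'n^'n \<Rightarrow> real^'n \<Rightarrow> real" where
  "wnorm P x = sqrt (x \<bullet> (P *v x))"

text \<open>
  A genuine projection when \<open>P\<close> is positive definite and \<open>D\<close> is nonempty, closed and convex:
  the minimizer then exists and is unique.
\<close>

definition wproj :: "real^'n^'n \<Rightarrow> (real^'n) set \<Rightarrow> real^'n \<Rightarrow> real^'n" where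
  "wproj P D x = arg_min (\<lambda>z. (wnorm P (z - x))\<^sup>2) (\<lambda>z. z \<in> D)"


text \<open>
  The algorithm, with $n - 1$ the cardinality of \<open>'r\<close>.
\<close>

definition T_mat :: "real \<Rightarrow> real^'r^1 \<Rightarrow> real^(1 + 'r)^(1 + 'r)" where
  "T_mat c1 C2 = four_block (mat c1) C2 0 (mat 1)"

definition A_tilde ::
  "real \<Rightarrow> real^'r^1 \<Rightarrow> real^1^'r \<Rightarrow> real^'r^'r \<Rightarrow> real^(1 + 'r)^(1 + 'r)" where
  "A_tilde c1 C2 A21 A22 =
     T_mat c1 C2 ** four_block (mat 1) 0 A21 A22 ** matrix_inv (T_mat c1 C2)"

definition B_tilde :: "real \<Rightarrow> real^1^(1 + 'r::finite)" where
  "B_tilde c1 = vcat (mat c1) 0"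

definition C_tilde :: "real^(1 + 'r::finite)^1" where
  "C_tilde = hcat (mat 1) 0"


text \<open>
  Both lines of the filter have the shape $(E \otimes I_d) \zeta + (F \otimes I_d) y
  + (G \otimes I_d) u$.
\<close>

definition filter_map ::
  "real^'p^'k \<Rightarrow> real^1^'k \<Rightarrow> real^1^'k \<Rightarrow> real^('p \<times> 'd) \<Rightarrow> real^'d \<Rightarrow> real^'d \<Rightarrow> real^('k \<times> 'd)"
where
  "filter_map E F G \<zeta> y u = kronI E *v \<zeta> + kronI F *v single y + kronI G *v single u"

text \<open>
  If \<open>A\<close> is Schur stable, as is assumed wherever this is used, the pair \<open>(\<zeta>s, hs)\<close> below exists
  and is unique.
\<close>

definition truncated_hard_iqc ::
  "real \<Rightarrow> real \<Rightarrow> real^'p^'p \<Rightarrow> real^1^'p \<Rightarrow> real^1^'p \<Rightarrow> real^'p^'q \<Rightarrow> real^1^'q \<Rightarrow> real^1^'q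
     \<Rightarrow> real^('q \<times> 'd::finite)^('q \<times> 'd) \<Rightarrow> bool" where
  "truncated_hard_iqc m L A By Bu C Dy Du M \<longleftrightarrow>
     (\<forall>f \<in> S_class m L. \<forall>(y::nat \<Rightarrow> real^'d) u \<zeta> h ys us \<zeta>s hs.
        (\<forall>k. u k = grad f (y k)) \<and>
        (\<forall>k. \<zeta> (Suc k) = filter_map A By Bu (\<zeta> k) (y k) (u k)) \<and>
        (\<forall>k. h k = filter_map C Dy Du (\<zeta> k) (y k) (u k)) \<and>
        us = grad f ys \<and>
        \<zeta>s = filter_map A By Bu \<zeta>s ys us \<and>
        hs = filter_map C Dy Du \<zeta>s ys us \<longrightarrow>
        (\<forall>t T. t \<le> T \<longrightarrow> 0 \<le> (\<Sum>k=t..T. (h k - hs) \<bullet> (M *v (h k - hs)))))"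

text \<open>
  Index types are nonempty, so a filter without state ($p = 0$), whose output is
  $h_k = D^y_\Psi y_k + D^u_\Psi u_k$, needs its own version.
\<close>

definition static_map :: "real^1^'q \<Rightarrow> real^1^'q \<Rightarrow> real^'d \<Rightarrow> real^'d \<Rightarrow> real^('q \<times> 'd)" where
  "static_map Dy Du y u = kronI Dy *v single y + kronI Du *v single u"

definition static_truncated_hard_iqc ::
  "real \<Rightarrow> real \<Rightarrow> real^1^'q \<Rightarrow> real^1^'q \<Rightarrow> real^('q \<times> 'd::finite)^('q \<times> 'd) \<Rightarrow> bool" where
  "static_truncated_hard_iqc m L Dy Du M \<longleftrightarrow>
     (\<forall>f \<in> S_class m L. \<forall>(y::nat \<Rightarrow> real^'d) u h ys us hs.
        (\<forall>k. u k = grad f (y k)) \<and>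
        (\<forall>k. h k = static_map Dy Du (y k) (u k)) \<and>
        us = grad f ys \<and>
        hs = static_map Dy Du ys us \<longrightarrow>
        (\<forall>t T. t \<le> T \<longrightarrow> 0 \<le> (\<Sum>k=t..T. (h k - hs) \<bullet> (M *v (h k - hs)))))"


definition A_hat ::
  "real^(1 + 'r::finite)^(1 + 'r) \<Rightarrow> real^'p^'p \<Rightarrow> real^1^'p \<Rightarrow> real^((1 + 'r) + 'p)^((1 + 'r) + 'p)" where
  "A_hat At A By = four_block At 0 (By ** C_tilde) A"

definition B_hat :: "real^1^(1 + 'r::finite) \<Rightarrow> real^1^'p \<Rightarrow> real^1^((1 + 'r) + 'p)" where
  "B_hat Bt Bu = vcat Bt Bu"

definition C_hat :: "real^'p^'q \<Rightarrow> real^1^'q \<Rightarrow> real^((1 + 'r::finite) + 'p)^'q" where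
  "C_hat C Dy = hcat (Dy ** C_tilde) C"

definition lmi ::
  "real^'x^'x \<Rightarrow> real^'u^'x \<Rightarrow> real^'x^'h \<Rightarrow> real^'u^'h \<Rightarrow> real^'x^'x \<Rightarrow> real^'h^'h \<Rightarrow> real \<Rightarrow> bool"
where
  "lmi A B C D P M \<rho> \<longleftrightarrow> neg_semidef
     (four_block (transpose A ** P ** A - \<rho>\<^sup>2 *\<^sub>R P) (transpose A ** P ** B)
                 (transpose B ** P ** A)              (transpose B ** P ** B)
      + vcat (transpose C) (transpose D) ** M ** hcat C D)"

text \<open>
  Here \<open>i\<close> is the index of the block \<open>y\<close> of the state, so that \<open>{z. block i z \<in> \<Omega>}\<close> is
  the product of \<open>\<Omega>\<close> with the full space of the remaining blocks.
\<close>

definition projected_fixed_points ::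
  "(real^'d \<Rightarrow> real) \<Rightarrow> (real^'d) set \<Rightarrow> 'x::finite \<Rightarrow> real^'x^'x \<Rightarrow> real^1^'x \<Rightarrow> real^'x^'x
     \<Rightarrow> ((real^'d) \<times> (real^'d) \<times> (real^('x \<times> 'd))) set" where
  "projected_fixed_points f \<Omega> i A B P = {(u, y, x).
     x = wproj (kronI P) {z. block i z \<in> \<Omega>} (kronI A *v x + kronI B *v single u) \<and>
     u = grad f y \<and> y = block i x}"

end

theory Submission
  imports Defs
begin

text \<open>
  Since \<open>m/2 |y|\<^sup>2\<close> belongs to the function class, the constraint on the filter and the linear
  matrix inequality make \<open>F = A + m B e\<^sub>i\<^sup>T\<close> a contraction in the \<open>P\<close>-norm, where \<open>i\<close> is the block
  \<open>y\<close> of the state.  A point \<open>x\<close> is fixed by the projected algorithm iff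
  \<open>x - A x - B u = P\<^sup>-\<^sup>1 e\<^sub>i r\<close> with \<open>- r\<close> in the normal cone of \<open>\<Omega>\<close> at \<open>y\<close>.
  The integrator of the algorithm gives a row \<open>w\<^sup>T\<close> with \<open>w\<^sup>T A = w\<^sup>T\<close> and \<open>w\<^sup>T B = 1\<close>; applying it yields
  \<open>- u = \<kappa> r\<close> with \<open>\<kappa> = w\<^sup>T P\<^sup>-\<^sup>1 e\<^sub>i\<close>.  Contractivity of \<open>F\<close> forces \<open>\<kappa> < 0\<close>, so that the fixed point
  equation implies the optimality condition \<open>- \<nabla>f(y) \<in> N\<^sub>\<Omega>(y)\<close>; conversely the optimal \<open>y\<close>
  determines \<open>u\<close>, \<open>r\<close> and, as \<open>I - F\<close> is invertible, \<open>x\<close>.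
\<close>

section \<open>Strongly monotone gradients\<close>

lemma GDERIV_along_line:
  assumes "GDERIV f (x + t *\<^sub>R d) :> g"
  shows "((\<lambda>s. f (x + s *\<^sub>R d)) has_real_derivative (g \<bullet> d)) (at t)"
proof -
  have "((\<lambda>s. f (x + s *\<^sub>R d)) has_derivative (\<lambda>s. (s *\<^sub>R d) \<bullet> g)) (at t)"
    using assms unfolding gderiv_def
    by (rule has_derivative_compose[rotated]) (auto intro!: derivative_eq_intros)
  then show ?thesis
    unfolding has_field_derivative_def
    by (rule has_derivative_eq_rhs) (auto simp: inner_commute mult.commute)
qed

text \<open>Mean value theorem on the segment from \<open>x\<close> to \<open>y\<close>: with the
  quadratic \<open>m / 2 * (norm d)\<^sup>2 * t\<^sup>2\<close> subtracted, strong monotonicity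
  makes the slope at the intermediate point at least \<open>g x \<bullet> d\<close>.\<close>

lemma strong_monotone_lower_bound:
  fixes f :: "'a::real_inner \<Rightarrow> real"
  assumes der: "\<And>x. GDERIV f x :> g x"
    and mono: "\<And>x y. m * (norm (x - y))\<^sup>2 \<le> (g x - g y) \<bullet> (x - y)"
  shows "f x + g x \<bullet> (y - x) + m / 2 * (norm (y - x))\<^sup>2 \<le> f y"
proof -
  define d where "d = y - x"
  define \<phi> where "\<phi> t = f (x + t *\<^sub>R d) - m / 2 * (norm d)\<^sup>2 * t\<^sup>2" for t :: real
  have D: "(\<phi> has_real_derivative (g (x + t *\<^sub>R d) \<bullet> d - m * (norm d)\<^sup>2 * t)) (at t)" for t
  proof -
    have "((\<lambda>s. f (x + s *\<^sub>R d)) has_real_derivative (g (x + t *\<^sub>R d) \<bullet> d)) (at t)"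
      by (rule GDERIV_along_line[OF der])
    then show ?thesis
      unfolding \<phi>_def by (auto intro!: derivative_eq_intros)
  qed
  obtain t where t: "0 < t" "t < 1"
    and eq: "\<phi> 1 - \<phi> 0 = (1 - 0) * (g (x + t *\<^sub>R d) \<bullet> d - m * (norm d)\<^sup>2 * t)"
    using MVT2[of 0 1 \<phi> "\<lambda>t. g (x + t *\<^sub>R d) \<bullet> d - m * (norm d)\<^sup>2 * t", OF zero_less_one D]
    by blast
  have "m * (norm (t *\<^sub>R d))\<^sup>2 \<le> t * ((g (x + t *\<^sub>R d) - g x) \<bullet> d)"
    using mono[of "x + t *\<^sub>R d" x] by simp
  then have "t * (m * t * (norm d)\<^sup>2) \<le> t * ((g (x + t *\<^sub>R d) - g x) \<bullet> d)"
    by (simp add: power_mult_distrib power2_eq_square mult_ac)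
  then have "m * t * (norm d)\<^sup>2 \<le> (g (x + t *\<^sub>R d) - g x) \<bullet> d"
    using t by simp
  then show ?thesis
    using eq by (simp add: \<phi>_def d_def inner_diff_left algebra_simps)
qed

text \<open>Sufficiency follows from the quadratic lower bound. For necessity, a negative
  directional derivative would give smaller values on the segment towards \<open>y\<close>, which
  convexity keeps in \<open>S\<close>.\<close>

lemma strong_monotone_is_arg_min_iff:
  fixes f :: "'a::real_inner \<Rightarrow> real"
  assumes der: "\<And>x. GDERIV f x :> g x"
    and mono: "\<And>x y. m * (norm (x - y))\<^sup>2 \<le> (g x - g y) \<bullet> (x - y)"
    and m: "0 < m" and cv: "convex S"
  shows "is_arg_min f (\<lambda>x. x \<in> S) x \<longleftrightarrow> x \<in> S \<and> (\<forall>y\<in>S. 0 \<le> g x \<bullet> (y - x))"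
proof (intro iffI conjI ballI)
  assume *: "x \<in> S \<and> (\<forall>y\<in>S. 0 \<le> g x \<bullet> (y - x))"
  have "f x \<le> f y" if "y \<in> S" for y
  proof -
    have "0 \<le> m / 2 * (norm (y - x))\<^sup>2"
      using m by simp
    then show ?thesis
      using strong_monotone_lower_bound[OF der mono, of x y] * that
      by (smt (verit))
  qed
  then show "is_arg_min f (\<lambda>x. x \<in> S) x"
    using * by (auto simp: is_arg_min_linorder)
next
  assume *: "is_arg_min f (\<lambda>x. x \<in> S) x"
  then show x: "x \<in> S"
    by (simp add: is_arg_min_linorder)
  fix y assume y: "y \<in> S"
  have D: "((\<lambda>s. f (x + s *\<^sub>R (y - x))) has_real_derivative (g x \<bullet> (y - x))) (at 0)"
    using GDERIV_along_line[of f x 0 "y - x" "g x"] der by simp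
  show "0 \<le> g x \<bullet> (y - x)"
  proof (rule ccontr)
    assume "\<not> 0 \<le> g x \<bullet> (y - x)"
    then obtain e where e: "0 < e"
      and dec: "\<And>h. 0 < h \<Longrightarrow> h < e \<Longrightarrow> f (x + (0 + h) *\<^sub>R (y - x)) < f (x + 0 *\<^sub>R (y - x))"
      using DERIV_neg_dec_right[OF D] by auto
    \<comment> \<open>Strictly below \<open>e\<close> for the decrease, at most 1 to stay on the
      segment.\<close>
    define h where "h = min (e / 2) 1"
    have h: "0 < h" "h < e" "h \<le> 1"
      using e by (auto simp: h_def)
    have "x + h *\<^sub>R (y - x) \<in> S"
      using convexD_alt[OF cv x y, of h] h by (simp add: algebra_simps)
    then have "f x \<le> f (x + h *\<^sub>R (y - x))"
      using * by (simp add: is_arg_min_linorder)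
    then show False
      using dec[of h] h by simp
  qed
qed

text \<open>Each variational inequality is tested at the other solution; their sum contradicts
  strong monotonicity unless the points agree.\<close>

lemma strong_monotone_arg_min_unique:
  assumes mono: "\<And>x y. m * (norm (x - y))\<^sup>2 \<le> (g x - g y) \<bullet> (x - y)"
    and m: "0 < m"
    and x: "x \<in> S" "\<And>y. y \<in> S \<Longrightarrow> 0 \<le> g x \<bullet> (y - x)"
    and x': "x' \<in> S" "\<And>y. y \<in> S \<Longrightarrow> 0 \<le> g x' \<bullet> (y - x')"
  shows "x = x'"
proof -
  have "(g x - g x') \<bullet> (x - x') \<le> 0"
    using x(2)[OF x'(1)] x'(2)[OF x(1)] by (simp add: inner_diff_left inner_diff_right)
  then have "m * (norm (x - x'))\<^sup>2 \<le> 0"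
    using mono[of x x'] by simp
  then show ?thesis
    using m by (simp add: mult_le_0_iff)
qed

lemma strong_monotone_ex_is_arg_min:
  fixes f :: "'a::euclidean_space \<Rightarrow> real"
  assumes der: "\<And>x. GDERIV f x :> g x"
    and mono: "\<And>x y. m * (norm (x - y))\<^sup>2 \<le> (g x - g y) \<bullet> (x - y)"
    and m: "0 < m" and S: "closed S" "S \<noteq> {}"
  shows "\<exists>x. is_arg_min f (\<lambda>x. x \<in> S) x"
proof -
  obtain x0 where x0: "x0 \<in> S"
    using S by auto
  \<comment> \<open>Beyond this radius the quadratic term of the lower bound outweighs the linear
    one, so only a compact part of \<open>S\<close> matters.\<close>
  define R where "R = 2 * norm (g x0) / m"
  have far: "f x0 < f y" if "R < norm (y - x0)" for y
  proof -
    have R0: "0 \<le> R"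
      using m by (simp add: R_def)
    have "- (norm (g x0) * norm (y - x0)) \<le> g x0 \<bullet> (y - x0)"
      using Cauchy_Schwarz_ineq2[of "g x0" "y - x0"] by linarith
    moreover have "norm (g x0) < m / 2 * norm (y - x0)"
      using that m by (simp add: R_def field_simps)
    then have "norm (g x0) * norm (y - x0) < (m / 2 * norm (y - x0)) * norm (y - x0)"
      using R0 that by (intro mult_strict_right_mono) auto
    then have "norm (g x0) * norm (y - x0) < m / 2 * (norm (y - x0))\<^sup>2"
      by (simp only: power2_eq_square mult.assoc)
    ultimately show ?thesis
      using strong_monotone_lower_bound[OF der mono, of x0 y] by linarith
  qed
  have "continuous_on (S \<inter> cball x0 R) f"
    using der has_derivative_continuous unfolding gderiv_def
    by (intro continuous_at_imp_continuous_on ballI) blast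
  moreover have "compact (S \<inter> cball x0 R)"
    using S by (simp add: closed_Int_compact)
  moreover have "x0 \<in> S \<inter> cball x0 R"
    using x0 m by (simp add: R_def)
  ultimately obtain x where x: "x \<in> S \<inter> cball x0 R"
    and min: "\<And>y. y \<in> S \<inter> cball x0 R \<Longrightarrow> f x \<le> f y"
    using continuous_attains_inf[of "S \<inter> cball x0 R" f] by blast
  have "f x \<le> f y" if "y \<in> S" for y
  proof (cases "y \<in> cball x0 R")
    case True
    then show ?thesis
      using min that by blast
  next
    case False
    then have "f x0 < f y"
      using far by (simp add: dist_norm norm_minus_commute)
    then show ?thesis
      using min[OF \<open>x0 \<in> S \<inter> cball x0 R\<close>] by simp
  qed
  then show ?thesis
    using x by (auto simp: is_arg_min_linorder)
qed

section \<open>The operator \<open>grad\<close> and the quadratic test function\<close>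

lemma GDERIV_unique:
  fixes f :: "'a::real_inner \<Rightarrow> real"
  assumes "GDERIV f x :> g" and "GDERIV f x :> g'"
  shows "g = g'"
proof -
  have "(\<lambda>h. h \<bullet> g) = (\<lambda>h. h \<bullet> g')"
    using assms by (auto simp: gderiv_def intro: has_derivative_unique)
  then have "(g - g') \<bullet> g = (g - g') \<bullet> g'"
    by (rule fun_cong)
  then have "(g - g') \<bullet> (g - g') = 0"
    by (simp add: inner_diff_right)
  then show ?thesis
    by simp
qed

lemma grad_eqI: "GDERIV f x :> g \<Longrightarrow> grad f x = g"
  unfolding grad_def by (blast intro: GDERIV_unique)

text \<open>Riesz representation: the coordinates of the gradient are the values of the derivative
  on the basis.\<close>

lemma GDERIV_grad:
  fixes f :: "'a::euclidean_space \<Rightarrow> real"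
  assumes "f differentiable at x"
  shows "GDERIV f x :> grad f x"
proof -
  obtain f' where f': "(f has_derivative f') (at x)"
    using assms by (auto simp: differentiable_def)
  then have lin: "linear f'"
    by (rule has_derivative_linear)
  have "f' h = h \<bullet> (\<Sum>b\<in>Basis. f' b *\<^sub>R b)" for h
  proof -
    have "f' h = f' (\<Sum>b\<in>Basis. (h \<bullet> b) *\<^sub>R b)"
      by (simp add: euclidean_representation)
    also have "\<dots> = (\<Sum>b\<in>Basis. (h \<bullet> b) * f' b)"
      by (simp add: linear_sum[OF lin] linear_cmul[OF lin])
    finally show ?thesis
      by (simp add: inner_sum_right mult.commute)
  qed
  then have "f' = (\<lambda>h. h \<bullet> (\<Sum>b\<in>Basis. f' b *\<^sub>R b))"
    by blast
  then have "GDERIV f x :> (\<Sum>b\<in>Basis. f' b *\<^sub>R b)"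
    using f' unfolding gderiv_def by metis
  then show ?thesis
    using grad_eqI by metis
qed

lemma GDERIV_half_norm_square:
  "GDERIV (\<lambda>y::'a::real_inner. m * (norm y)\<^sup>2 / 2) y :> m *\<^sub>R y"
  unfolding gderiv_def power2_norm_eq_inner
  by (auto intro!: derivative_eq_intros simp: inner_commute)

lemma half_norm_square_in_S_class:
  assumes "m \<le> L"
  shows "(\<lambda>y::real^'d::finite. m * (norm y)\<^sup>2 / 2) \<in> S_class m L"
proof -
  have "(\<lambda>y::real^'d. m * (norm y)\<^sup>2 / 2) differentiable at x" for x
    using GDERIV_half_norm_square[of m x] unfolding gderiv_def differentiable_def by blast
  moreover have "(m *\<^sub>R x - m *\<^sub>R y) \<bullet> (x - y) = m * (norm (x - y))\<^sup>2" for x y :: "real^'d"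
    by (simp add: power2_norm_eq_inner flip: scaleR_diff_right)
  ultimately show ?thesis
    unfolding S_class_def mem_Collect_eq grad_eqI[OF GDERIV_half_norm_square]
    using assms by (simp add: mult_right_mono)
qed

section \<open>Weighted projections\<close>

lemma pos_def_inner_commute:
  assumes "pos_def P"
  shows "x \<bullet> (P *v y) = y \<bullet> (P *v x)"
  using assms by (metis dot_lmul_matrix inner_commute pos_def_def transpose_matrix_vector)

lemma pos_def_quadratic_nonneg: "pos_def P \<Longrightarrow> 0 \<le> x \<bullet> (P *v x)"
  unfolding pos_def_def by (cases "x = 0") (auto intro: less_imp_le)

lemma pos_def_bij: "pos_def P \<Longrightarrow> bij ((*v) P)"
proof -
  assume P: "pos_def P"
  have "x = 0" if "P *v x = 0" for x
    using P that unfolding pos_def_def by (metis inner_zero_right less_irrefl)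
  then have "inj ((*v) P)"
    by (simp add: linear_injective_0)
  then show ?thesis
    by (simp add: bij_def linear_injective_imp_surjective)
qed

text \<open>The constant is the minimum of the quadratic form on the unit sphere; homogeneity does
  the rest.\<close>

lemma pos_def_coercive:
  fixes P :: "real^'n^'n"
  assumes "pos_def P"
  obtains c where "0 < c" "\<And>x. c * (norm x)\<^sup>2 \<le> x \<bullet> (P *v x)"
proof -
  let ?S = "sphere 0 1 :: (real^'n) set"
  have "axis undefined 1 \<in> ?S"
    by (simp add: norm_axis_1)
  moreover have "continuous_on ?S (\<lambda>x. x \<bullet> (P *v x))"
    by (intro continuous_intros linear_continuous_on) (simp add: matrix_vector_mul_bounded_linear)
  ultimately obtain z where z: "z \<in> ?S" "\<And>x. x \<in> ?S \<Longrightarrow> z \<bullet> (P *v z) \<le> x \<bullet> (P *v x)"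
    using continuous_attains_inf[of ?S "\<lambda>x. x \<bullet> (P *v x)"] by (metis compact_sphere empty_iff)
  have "(z \<bullet> (P *v z)) * (norm x)\<^sup>2 \<le> x \<bullet> (P *v x)" for x
  proof (cases "x = 0")
    case False
    have "x /\<^sub>R norm x \<in> ?S"
      using False by simp
    from z(2)[OF this] have "z \<bullet> (P *v z) \<le> (x \<bullet> (P *v x)) / (norm x)\<^sup>2"
      by (simp add: matrix_vector_mult_scaleR power2_eq_square divide_inverse mult_ac)
    then show ?thesis
      using False by (simp add: field_simps)
  qed simp
  moreover have "0 < z \<bullet> (P *v z)"
    using assms z(1) unfolding pos_def_def by (metis dist_0_norm mem_sphere norm_zero zero_neq_one)
  ultimately show thesis
    using that by blast
qed

text \<open>The squared \<open>P\<close>-distance to \<open>z\<close> has gradient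
  \<open>2 *\<^sub>R (P *v (v - z))\<close>, strongly monotone by coercivity, so the optimality,
  existence and uniqueness results above apply to it.\<close>

lemma wproj_eq_iff:
  fixes P :: "real^'n^'n"
  assumes P: "pos_def P" and D: "closed D" "convex D" "D \<noteq> {}"
  shows "x = wproj P D z \<longleftrightarrow> x \<in> D \<and> (\<forall>v\<in>D. 0 \<le> (P *v (x - z)) \<bullet> (v - x))"
proof -
  define q where "q = (\<lambda>v. (wnorm P (v - z))\<^sup>2)"
  define g where "g v = 2 *\<^sub>R (P *v (v - z))" for v
  obtain c where c: "0 < c" "\<And>x. c * (norm x)\<^sup>2 \<le> x \<bullet> (P *v x)"
    using pos_def_coercive[OF P] by blast
  have q: "q v = (v - z) \<bullet> (P *v (v - z))" for v
    using pos_def_quadratic_nonneg[OF P] by (simp add: q_def wnorm_def)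
  have der: "GDERIV q v :> g v" for v
  proof -
    have "((\<lambda>v. P *v (v - z)) has_derivative (\<lambda>h. P *v h)) (at v)"
      by (rule has_derivative_eq_rhs,
          rule bounded_linear.has_derivative[OF matrix_vector_mul_bounded_linear])
         (auto intro!: derivative_eq_intros)
    moreover have "(P *v h) \<bullet> (v - z) = h \<bullet> (P *v (v - z))" for h
      by (metis inner_commute pos_def_inner_commute[OF P])
    ultimately show ?thesis
      unfolding gderiv_def q g_def by (auto intro!: derivative_eq_intros simp: inner_commute)
  qed
  have mono: "(2 * c) * (norm (v - v'))\<^sup>2 \<le> (g v - g v') \<bullet> (v - v')" for v v'
    using c(2)[of "v - v'"]
    by (simp add: g_def inner_commute matrix_vector_mult_diff_distrib
        flip: scaleR_diff_right)
  have c2: "0 < 2 * c"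
    using c by simp
  note iff = strong_monotone_is_arg_min_iff[OF der mono c2 D(2)]
  \<comment> \<open>\<open>arg_min\<close> is a choice operator: it denotes a minimizer only once
    one exists.\<close>
  have "is_arg_min q (\<lambda>v. v \<in> D) (wproj P D z)"
    unfolding wproj_def arg_min_def q_def[symmetric]
    using strong_monotone_ex_is_arg_min[OF der mono c2 D(1,3)] by (rule someI_ex)
  then have "x = wproj P D z \<longleftrightarrow> is_arg_min q (\<lambda>v. v \<in> D) x"
    unfolding iff using strong_monotone_arg_min_unique[OF mono c2] by metis
  then show ?thesis
    unfolding iff by (simp add: g_def)
qed

section \<open>Kronecker products with the identity\<close>

text \<open>Collects one coordinate from every block, transversally to \<open>block\<close>.
  Matrices \<open>kronI A\<close> act on each slice separately, so equations in all coordinates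
  split into independent ones with the matrix \<open>A\<close>.\<close>

definition slice :: "'d \<Rightarrow> real^('n \<times> 'd::finite) \<Rightarrow> real^'n" where
  "slice a X = (\<chi> j. X $ (j, a))"

definition unslice :: "('d \<Rightarrow> real^'n) \<Rightarrow> real^('n \<times> 'd::finite)" where
  "unslice x = (\<chi> k. x (snd k) $ fst k)"

lemma slice_unslice [simp]: "slice a (unslice x) = x a"
  by (simp add: slice_def unslice_def vec_eq_iff)

lemma slice_eqI: "(\<And>a. slice a X = slice a Y) \<Longrightarrow> X = Y"
  by (simp add: slice_def vec_eq_iff)

lemma slice_add [simp]: "slice a (X + Y) = slice a X + slice a Y"
  and slice_diff [simp]: "slice a (X - Y) = slice a X - slice a Y"
  and slice_zero [simp]: "slice a 0 = 0"
  by (simp_all add: slice_def vec_eq_iff)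

lemma slice_single [simp]: "slice a (single u) = vec (u $ a)"
  by (simp add: slice_def single_def vec_eq_iff)

lemma single_zero: "single 0 = 0"
  by (simp add: single_def vec_eq_iff)

lemma block_nth: "block i X $ a = slice a X $ i"
  by (simp add: block_def slice_def)

lemma inner_slice: "X \<bullet> Y = (\<Sum>a\<in>UNIV. slice a X \<bullet> slice a (Y :: real^('n::finite \<times> 'd::finite)))"
proof -
  have "X \<bullet> Y = (\<Sum>k\<in>UNIV \<times> UNIV. X $ k * Y $ k)"
    by (simp add: inner_vec_def)
  also have "\<dots> = (\<Sum>j\<in>UNIV. \<Sum>a\<in>UNIV. X $ (j, a) * Y $ (j, a))"
    by (simp add: sum.cartesian_product case_prod_unfold)
  also have "\<dots> = (\<Sum>a\<in>UNIV. slice a X \<bullet> slice a Y)"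
    by (subst sum.swap) (simp add: inner_vec_def slice_def)
  finally show ?thesis .
qed

lemma slice_kronI [simp]:
  fixes A :: "real^'n::finite^'m::finite" and X :: "real^('n \<times> 'd::finite)"
  shows "slice a (kronI A *v X) = A *v slice a X"
proof -
  have "(\<Sum>k\<in>UNIV. kronI A $ (i, a) $ k * X $ k) = (\<Sum>j\<in>UNIV. A $ i $ j * X $ (j, a))" for i
  proof -
    have "(\<Sum>k\<in>UNIV. kronI A $ (i, a) $ k * X $ k)
      = (\<Sum>j\<in>UNIV. \<Sum>b\<in>UNIV. kronI A $ (i, a) $ (j, b) * X $ (j, b))"
      by (simp add: sum.cartesian_product case_prod_unfold)
    also have "\<dots> = (\<Sum>j\<in>UNIV. \<Sum>b\<in>UNIV. if b = a then A $ i $ j * X $ (j, a) else 0)"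
      by (intro sum.cong) (auto simp: kronI_def kron_def mat_def)
    finally show ?thesis
      by simp
  qed
  then show ?thesis
    by (simp add: slice_def matrix_vector_mult_def vec_eq_iff)
qed

text \<open>On a vector with all slices equal to \<open>v\<close>, the large quadratic form is a
  positive multiple of the small one.\<close>

lemma pos_def_kronI_factor:
  fixes P :: "real^'n::finite^'n"
  assumes "pos_def (kronI P :: real^('n \<times> 'd::finite)^('n \<times> 'd))"
  shows "pos_def P"
  unfolding pos_def_def
proof (intro conjI allI impI)
  have "transpose (kronI P :: real^('n \<times> 'd)^('n \<times> 'd)) $ (j, undefined) $ (k, undefined)
      = (kronI P :: real^('n \<times> 'd)^('n \<times> 'd)) $ (j, undefined) $ (k, undefined)" for j k
    using assms by (simp add: pos_def_def)
  then show "transpose P = P"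
    by (simp add: kronI_def kron_def mat_def transpose_def vec_eq_iff)
  fix v :: "real^'n" assume v: "v \<noteq> 0"
  let ?V = "unslice (\<lambda>a::'d. v) :: real^('n \<times> 'd)"
  have "?V \<noteq> 0"
    using v by (metis slice_unslice slice_zero)
  then have "0 < ?V \<bullet> (kronI P *v ?V)"
    using assms by (simp add: pos_def_def)
  then show "0 < v \<bullet> (P *v v)"
    by (simp add: inner_slice zero_less_mult_iff)
qed

section \<open>Fixed points of the projected algorithm\<close>

lemma vec_eq_scaleR: "(vec c :: real^'n) = c *\<^sub>R 1"
  by (simp add: vec_eq_iff)

text \<open>
  Applying the left fixed vector \<open>w\<close> of \<open>A\<close> to \<open>G = I - F\<close>, where \<open>F = A + m B e\<^sub>i\<^sup>T\<close> is a
  contraction, gives \<open>w\<^sup>T G = - m e\<^sub>i\<^sup>T\<close>.  Hence \<open>w\<^sup>T P\<^sup>-\<^sup>1 e\<^sub>i = - m e\<^sub>i\<^sup>T (P G)\<^sup>-\<^sup>1 e\<^sub>i\<close>, which is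
  negative because the symmetric part of \<open>P G\<close> is positive definite.
\<close>

lemma contraction_fixed_vector:
  fixes A P :: "real^'x::finite^'x" and B :: "real^1^'x" and w :: "real^'x"
  assumes P: "pos_def P" and \<rho>: "0 < \<rho>" "\<rho> < 1" and m: "0 < m"
    and wA: "\<And>x. w \<bullet> (A *v x) = w \<bullet> x" and wB: "\<And>v. w \<bullet> (B *v v) = v $ 1"
    and contr: "\<And>x. (A *v x + B *v vec (m * x $ i)) \<bullet> (P *v (A *v x + B *v vec (m * x $ i)))
                 \<le> \<rho>\<^sup>2 * (x \<bullet> (P *v x))"
  obtains p where "P *v p = axis i 1" "w \<bullet> p < 0" "bij (\<lambda>x. x - A *v x - B *v vec (m * x $ i))"
proof -
  define F where "F x = A *v x + B *v vec (m * x $ i)" for x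
  define G where "G x = x - F x" for x
  have \<rho>2: "\<rho>\<^sup>2 < 1"
    using \<rho> by (simp add: power_less_one_iff)
  have linF: "linear F"
    unfolding F_def
    by (rule linearI)
       (simp_all add: vec_eq_scaleR matrix_vector_mult_scaleR algebra_simps
         matrix_vector_right_distrib)
  then have linG: "linear G"
    unfolding G_def by (intro linear_compose_sub linear_ident)
  \<comment> \<open>Expand the squared \<open>P\<close>-norm of \<open>x - F x\<close>: contraction
    bounds the cross term by \<open>(1 + \<rho>\<^sup>2) / 2\<close> times that of \<open>x\<close>,
    a factor below 1.\<close>
  have pos: "0 < x \<bullet> (P *v G x)" if "x \<noteq> 0" for x
  proof -
    have "0 \<le> (x - F x) \<bullet> (P *v (x - F x))"
      by (rule pos_def_quadratic_nonneg[OF P])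
    also have "\<dots> = x \<bullet> (P *v x) - 2 * (x \<bullet> (P *v F x)) + F x \<bullet> (P *v F x)"
      by (simp add: inner_diff_left inner_diff_right matrix_vector_mult_diff_distrib
          pos_def_inner_commute[OF P, of "F x" x])
    also have "\<dots> \<le> x \<bullet> (P *v x) - 2 * (x \<bullet> (P *v F x)) + \<rho>\<^sup>2 * (x \<bullet> (P *v x))"
      using contr[of x] by (simp add: F_def)
    finally have "2 * (x \<bullet> (P *v F x)) \<le> (1 + \<rho>\<^sup>2) * (x \<bullet> (P *v x))"
      by (simp add: algebra_simps)
    moreover have "0 < x \<bullet> (P *v x)"
      using P that by (simp add: pos_def_def)
    then have "(1 + \<rho>\<^sup>2) * (x \<bullet> (P *v x)) < 2 * (x \<bullet> (P *v x))"
      using \<rho>2 by simp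
    ultimately show ?thesis
      by (simp add: G_def inner_diff_right matrix_vector_mult_diff_distrib)
  qed
  then have "x = 0" if "G x = 0" for x
    using that by (metis inner_zero_right less_irrefl matrix_vector_mult_0_right)
  then have inj: "inj G"
    using linG by (simp add: linear_injective_0)
  then have surj: "surj G"
    using linG by (simp add: linear_injective_imp_surjective)
  obtain p where p: "P *v p = axis i 1"
    using pos_def_bij[OF P] by (metis bij_pointE)
  obtain q where q: "G q = p"
    using surj by (metis surjD)
  have "q \<noteq> 0"
    using p q linear_0[OF linG] by (metis axis_eq_0_iff matrix_vector_mult_0_right zero_neq_one)
  \<comment> \<open>Since \<open>P *v G q = axis i 1\<close>, the form in \<open>pos\<close> at
    \<open>q\<close> is just the entry \<open>q $ i\<close>.\<close>
  then have "0 < q $ i"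
    using pos[of q] by (simp add: q p inner_axis)
  moreover have "w \<bullet> p = - m * q $ i"
    unfolding q[symmetric] by (simp add: G_def F_def inner_diff_right inner_add_right wA wB)
  ultimately have "w \<bullet> p < 0"
    using m by simp
  moreover have "G = (\<lambda>x. x - A *v x - B *v vec (m * x $ i))"
    by (auto simp: G_def F_def)
  ultimately show thesis
    using that p inj surj by (metis bij_def)
qed

text \<open>All blocks except \<open>i\<close> are unconstrained, so \<open>R\<close> must vanish
  there; what remains is the inequality on \<open>\<Omega>\<close>.\<close>

lemma variational_inequality_block:
  fixes X R :: "real^('x::finite \<times> 'd::finite)"
  assumes X: "block i X \<in> \<Omega>"
  shows "(\<forall>V. block i V \<in> \<Omega> \<longrightarrow> 0 \<le> R \<bullet> (V - X)) \<longleftrightarrow>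
    (\<forall>a. slice a R = block i R $ a *\<^sub>R axis i 1) \<and> (\<forall>y\<in>\<Omega>. 0 \<le> block i R \<bullet> (y - block i X))"
    (is "?L \<longleftrightarrow> ?R")
proof
  assume R: ?R
  have "R \<bullet> (V - X) = block i R \<bullet> (block i V - block i X)" for V
  proof -
    have "R \<bullet> (V - X) = (\<Sum>a\<in>UNIV. (block i R $ a *\<^sub>R axis i 1) \<bullet> slice a (V - X))"
      using R by (simp add: inner_slice)
    also have "\<dots> = (\<Sum>a\<in>UNIV. block i R $ a * (block i V - block i X) $ a)"
      by (intro sum.cong) (auto simp: inner_axis' block_nth)
    finally show ?thesis
      by (simp add: inner_vec_def)
  qed
  then show ?L
    using R by simp
next
  assume L: ?L
  have off: "R $ (j, a) = 0" if "j \<noteq> i" for j a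
  proof -
    \<comment> \<open>A feasible move against \<open>R\<close> in one free coordinate: its inner
      product with \<open>R\<close> is minus a square.\<close>
    have "block i (X + axis (j, a) (- (R $ (j, a)))) = block i X"
      using that by (simp add: block_def axis_def vec_eq_iff)
    then have "0 \<le> R \<bullet> axis (j, a) (- (R $ (j, a)))"
      using L X by (metis add_diff_cancel_left')
    then have "0 \<le> - (R $ (j, a) * R $ (j, a))"
      by (simp add: inner_axis)
    then show ?thesis
      using not_square_less_zero[of "R $ (j, a)"] by (auto simp: le_less)
  qed
  have sl: "slice a R = block i R $ a *\<^sub>R axis i 1" for a
    using off by (auto simp: slice_def block_def vec_eq_iff axis_def)
  have "0 \<le> block i R \<bullet> (y - block i X)" if y: "y \<in> \<Omega>" for y
  proof -
    \<comment> \<open>\<open>X\<close> with block \<open>i\<close> replaced by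
      \<open>y\<close>.\<close>
    let ?V = "unslice (\<lambda>a. slice a X + (y $ a - block i X $ a) *\<^sub>R axis i 1)"
    have "block i ?V = y"
      by (simp add: vec_eq_iff block_nth)
    then have "0 \<le> R \<bullet> (?V - X)"
      using L y by simp
    also have "\<dots> = (\<Sum>a\<in>UNIV. block i R $ a * (y $ a - block i X $ a))"
      unfolding inner_slice[of R] by (intro sum.cong) (auto simp: inner_axis block_nth)
    finally show ?thesis
      by (simp add: inner_vec_def)
  qed
  then show ?R
    using sl by blast
qed

lemma block_add [simp]: "block i (X + Y) = block i X + block i Y"
  and block_scaleR [simp]: "block i (c *\<^sub>R X) = c *\<^sub>R block i X"
  by (simp_all add: block_def vec_eq_iff)

lemma linear_block: "linear (block i)"
  by (rule linearI) simp_all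

text \<open>The left fixed vector \<open>w\<close> and the contraction enter as abstract hypotheses,
  so that the algorithm with a dynamic filter and the one with a static filter are both
  instances.\<close>

lemma projected_fixed_points_unique:
  fixes f :: "real^'d::finite \<Rightarrow> real" and A P :: "real^'x::finite^'x" and B :: "real^1^'x"
  assumes m: "0 < m" and f: "f \<in> S_class m L"
    and \<Omega>: "\<Omega> \<noteq> {}" "closed \<Omega>" "convex \<Omega>"
    and P: "pos_def (kronI P :: real^('x \<times> 'd)^('x \<times> 'd))" and \<rho>: "0 < \<rho>" "\<rho> < 1"
    and wA: "\<And>x. w \<bullet> (A *v x) = w \<bullet> x" and wB: "\<And>v. w \<bullet> (B *v v) = v $ 1"
    and contr: "\<And>(X :: real^('x \<times> 'd)) Z.
      Z = kronI A *v X + kronI B *v single (m *\<^sub>R block i X) \<Longrightarrow>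
      Z \<bullet> (kronI P *v Z) \<le> \<rho>\<^sup>2 * (X \<bullet> (kronI P *v X))"
  shows "\<exists>us ys xs. projected_fixed_points f \<Omega> i A B P = {(us, ys, xs)} \<and>
           {y. is_arg_min f (\<lambda>y. y \<in> \<Omega>) y} = {ys}"
proof -
  note P' = pos_def_kronI_factor[OF P]
  have der: "GDERIV f x :> grad f x" for x
    using f by (simp add: S_class_def GDERIV_grad)
  have mono: "m * (norm (x - y))\<^sup>2 \<le> (grad f x - grad f y) \<bullet> (x - y)" for x y
    using f by (simp add: S_class_def)
  note opt_iff = strong_monotone_is_arg_min_iff[OF der mono m \<Omega>(3)]
  obtain ys where ys: "is_arg_min f (\<lambda>y. y \<in> \<Omega>) ys"
    using strong_monotone_ex_is_arg_min[OF der mono m \<Omega>(2,1)] by blast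
  have opt: "{y. is_arg_min f (\<lambda>y. y \<in> \<Omega>) y} = {ys}"
    using ys strong_monotone_arg_min_unique[OF mono m] unfolding opt_iff by blast
  \<comment> \<open>Equal slices \<open>x\<close> multiply both sides by the same positive
    dimension.\<close>
  have contr': "(A *v x + B *v vec (m * x $ i)) \<bullet> (P *v (A *v x + B *v vec (m * x $ i)))
                 \<le> \<rho>\<^sup>2 * (x \<bullet> (P *v x))" for x
    using contr[OF refl, of "unslice (\<lambda>a. x)"]
    by (simp add: inner_slice block_nth mult.left_commute)
  obtain p where p: "P *v p = axis i 1" and \<kappa>: "w \<bullet> p < 0"
    and G: "bij (\<lambda>x. x - A *v x - B *v vec (m * x $ i))"
    using contraction_fixed_vector[OF P' \<rho> m wA wB contr'] by blast
  define \<kappa> where "\<kappa> = w \<bullet> p"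
  define D where "D = {Z :: real^('x \<times> 'd). block i Z \<in> \<Omega>}"
  have D: "closed D" "convex D" "D \<noteq> {}"
  proof -
    have D_vimage: "D = block i -` \<Omega>"
      by (auto simp: D_def)
    show "closed D"
      unfolding D_vimage using \<Omega>(2) linear_continuous_at[OF linear_linear[THEN iffD2, OF linear_block]]
      by (intro continuous_closed_vimage) auto
    show "convex D"
      unfolding D_vimage using linear_block \<Omega>(3) by (rule convex_linear_vimage)
    obtain y where "y \<in> \<Omega>"
      using \<Omega>(1) by blast
    then have "unslice (\<lambda>a. vec (y $ a)) \<in> D"
      by (simp add: D_def block_def unslice_def)
    then show "D \<noteq> {}"
      by blast
  qed
  have P_inj: "P *v x = P *v y \<longleftrightarrow> x = y" for x y
    using pos_def_bij[OF P'] by (simp add: bij_def inj_eq)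
  have fp_iff: "X = wproj (kronI P) D (kronI A *v X + kronI B *v single u) \<longleftrightarrow>
      block i X \<in> \<Omega> \<and> (\<forall>y\<in>\<Omega>. 0 \<le> u \<bullet> (y - block i X)) \<and>
      (\<forall>a. slice a X - A *v slice a X - B *v vec (u $ a) = (- u $ a / \<kappa>) *\<^sub>R p)"
    (is "_ \<longleftrightarrow> ?R") for X and u :: "real^'d"
  proof -
    \<comment> \<open>Half the gradient at \<open>X\<close> of the projection objective.\<close>
    define Q where "Q = kronI P *v (X - (kronI A *v X + kronI B *v single u))"
    have Q: "slice a Q = P *v (slice a X - A *v slice a X - B *v vec (u $ a))" for a
      by (simp add: Q_def algebra_simps)
    \<comment> \<open>Cancelling \<open>P\<close> turns \<open>axis i 1\<close> into
      \<open>p\<close>; pairing with \<open>w\<close>, which annihilates \<open>x - A *v x\<close>,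
      then fixes \<open>r\<close>.\<close>
    have slice_eq: "slice a Q = r *\<^sub>R axis i 1 \<longleftrightarrow>
        r = - u $ a / \<kappa> \<and> slice a X - A *v slice a X - B *v vec (u $ a) = r *\<^sub>R p" for a r
    proof -
      have "slice a Q = r *\<^sub>R axis i 1 \<longleftrightarrow>
          slice a X - A *v slice a X - B *v vec (u $ a) = r *\<^sub>R p"
        unfolding Q p[symmetric] matrix_vector_mult_scaleR[symmetric] P_inj ..
      moreover have "r = - u $ a / \<kappa>"
        if eq: "slice a X - A *v slice a X - B *v vec (u $ a) = r *\<^sub>R p"
      proof -
        have "w \<bullet> (slice a X - A *v slice a X - B *v vec (u $ a)) = r * \<kappa>"
          unfolding eq by (simp add: \<kappa>_def)
        then have "- u $ a = r * \<kappa>"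
          by (simp add: inner_diff_right wA wB)
        then show ?thesis
          using \<kappa> by (simp add: \<kappa>_def field_simps)
      qed
      ultimately show ?thesis
        by blast
    qed
    \<comment> \<open>Here the sign of \<open>\<kappa>\<close> is decisive: the residual is a
      positive multiple of \<open>u\<close>, so both satisfy the same inequalities.\<close>
    have sc: "(0 \<le> (- (1 / \<kappa>) *\<^sub>R u) \<bullet> v) = (0 \<le> u \<bullet> v)" for v
      using \<kappa> by (simp add: \<kappa>_def zero_le_divide_iff divide_le_0_iff)
    have "X = wproj (kronI P) D (kronI A *v X + kronI B *v single u) \<longleftrightarrow>
      block i X \<in> \<Omega> \<and> (\<forall>V. block i V \<in> \<Omega> \<longrightarrow> 0 \<le> Q \<bullet> (V - X))"
      unfolding wproj_eq_iff[OF P D] by (auto simp: D_def Q_def)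
    also have "\<dots> \<longleftrightarrow> block i X \<in> \<Omega> \<and> (\<forall>a. slice a Q = block i Q $ a *\<^sub>R axis i 1) \<and>
        (\<forall>y\<in>\<Omega>. 0 \<le> block i Q \<bullet> (y - block i X))"
      using variational_inequality_block[of i X \<Omega> Q] by blast
    also have "\<dots> \<longleftrightarrow> ?R"
    proof (rule conj_cong[OF refl], rule iffI)
      assume *: "(\<forall>a. slice a Q = block i Q $ a *\<^sub>R axis i 1) \<and>
        (\<forall>y\<in>\<Omega>. 0 \<le> block i Q \<bullet> (y - block i X))"
      then have "block i Q $ a = - u $ a / \<kappa>" for a
        using slice_eq by blast
      then have "block i Q = - (1 / \<kappa>) *\<^sub>R u"
        by (simp add: vec_eq_iff)
      then show "(\<forall>y\<in>\<Omega>. 0 \<le> u \<bullet> (y - block i X)) \<and>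
          (\<forall>a. slice a X - A *v slice a X - B *v vec (u $ a) = (- u $ a / \<kappa>) *\<^sub>R p)"
        using * slice_eq sc by metis
    next
      assume *: "(\<forall>y\<in>\<Omega>. 0 \<le> u \<bullet> (y - block i X)) \<and>
          (\<forall>a. slice a X - A *v slice a X - B *v vec (u $ a) = (- u $ a / \<kappa>) *\<^sub>R p)"
      then have sl: "slice a Q = (- u $ a / \<kappa>) *\<^sub>R axis i 1" for a
        using slice_eq by blast
      then have "block i Q = - (1 / \<kappa>) *\<^sub>R u"
        by (simp add: vec_eq_iff block_nth)
      then show "(\<forall>a. slice a Q = block i Q $ a *\<^sub>R axis i 1) \<and>
        (\<forall>y\<in>\<Omega>. 0 \<le> block i Q \<bullet> (y - block i X))"
        using * sl sc by (simp add: block_nth)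
    qed
    finally show ?thesis .
  qed
  \<comment> \<open>The map \<open>x - A *v x\<close> is singular because of \<open>w\<close>;
    adding the feedback \<open>m * x $ i\<close> makes it bijective, and \<open>rhs\<close>
    compensates by \<open>us - m ys\<close>.\<close>
  define g where "g x = x - A *v x - B *v vec (m * x $ i)" for x
  define us where "us = grad f ys"
  define rhs where "rhs a = B *v vec (us $ a - m * ys $ a) + (- us $ a / \<kappa>) *\<^sub>R p" for a
  have vec_diff: "B *v vec (s - t) = B *v vec s - B *v vec t" for s t :: real
    by (simp add: vec_eq_iff flip: matrix_vector_mult_diff_distrib vec_sub)
  have sol_iff: "x - A *v x - B *v vec (us $ a) = (- us $ a / \<kappa>) *\<^sub>R p \<and> x $ i = ys $ a \<longleftrightarrow>
      g x = rhs a" for x a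
  proof
    assume "x - A *v x - B *v vec (us $ a) = (- us $ a / \<kappa>) *\<^sub>R p \<and> x $ i = ys $ a"
    then show "g x = rhs a"
      by (simp add: g_def rhs_def vec_diff algebra_simps)
  next
    assume eq: "g x = rhs a"
    \<comment> \<open>Pairing both sides with \<open>w\<close> recovers the requirement on
      \<open>x $ i\<close>, so solving \<open>g x = rhs a\<close> enforces it automatically.\<close>
    have "w \<bullet> g x = - (m * x $ i)"
      by (simp add: g_def inner_diff_right wA wB)
    moreover have "w \<bullet> rhs a = - (m * ys $ a)"
      using \<kappa> by (simp add: rhs_def inner_add_right inner_diff_right wB flip: \<kappa>_def)
    ultimately have "x $ i = ys $ a"
      using eq m by simp
    then show "x - A *v x - B *v vec (us $ a) = (- us $ a / \<kappa>) *\<^sub>R p \<and> x $ i = ys $ a"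
      using eq by (simp add: g_def rhs_def vec_diff algebra_simps)
  qed
  have "bij g"
    using G unfolding g_def .
  define xs where "xs = unslice (\<lambda>a. inv g (rhs a))"
  have xs: "g (slice a x) = rhs a \<longleftrightarrow> slice a x = slice a xs" for a x
    using \<open>bij g\<close> by (simp add: xs_def) (metis bij_inv_eq_iff)
  have "(u, y, x) \<in> projected_fixed_points f \<Omega> i A B P \<longleftrightarrow> (u, y, x) = (us, ys, xs)" for u y x
  proof -
    have "(u, y, x) \<in> projected_fixed_points f \<Omega> i A B P \<longleftrightarrow>
      y = block i x \<and> u = grad f y \<and> y \<in> \<Omega> \<and> (\<forall>z\<in>\<Omega>. 0 \<le> grad f y \<bullet> (z - y)) \<and>
      (\<forall>a. slice a x - A *v slice a x - B *v vec (u $ a) = (- u $ a / \<kappa>) *\<^sub>R p)"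
      unfolding projected_fixed_points_def using fp_iff[of x u] by (auto simp: D_def)
    also have "\<dots> \<longleftrightarrow> y = ys \<and> u = us \<and> y = block i x \<and>
      (\<forall>a. slice a x - A *v slice a x - B *v vec (us $ a) = (- us $ a / \<kappa>) *\<^sub>R p)"
    proof -
      have "y \<in> \<Omega> \<and> (\<forall>z\<in>\<Omega>. 0 \<le> grad f y \<bullet> (z - y)) \<longleftrightarrow> y = ys"
        using opt opt_iff[of y] by blast
      then show ?thesis
        unfolding us_def by metis
    qed
    also have "\<dots> \<longleftrightarrow> y = ys \<and> u = us \<and> (\<forall>a. g (slice a x) = rhs a)"
      unfolding sol_iff[symmetric] by (auto simp: vec_eq_iff block_nth)
    also have "\<dots> \<longleftrightarrow> (u, y, x) = (us, ys, xs)"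
      using slice_eqI xs by auto
    finally show ?thesis .
  qed
  then have "projected_fixed_points f \<Omega> i A B P = {(us, ys, xs)}"
    by auto
  then show ?thesis
    using opt by blast
qed

section \<open>The linear matrix inequality\<close>

definition stack :: "real^'n \<Rightarrow> real^'k \<Rightarrow> real^('n::finite + 'k::finite)" where
  "stack x u = (\<chi> k. case k of Inl a \<Rightarrow> x $ a | Inr b \<Rightarrow> u $ b)"

lemma stack_nth [simp]: "stack x u $ Inl a = x $ a" "stack x u $ Inr b = u $ b"
  by (simp_all add: stack_def)

lemma sum_UNIV_Plus:
  fixes F :: "'n::finite + 'k::finite \<Rightarrow> real"
  shows "sum F UNIV = (\<Sum>a\<in>UNIV. F (Inl a)) + (\<Sum>b\<in>UNIV. F (Inr b))"
  unfolding UNIV_Plus_UNIV[symmetric] by (simp add: sum.Plus o_def del: UNIV_Plus_UNIV)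

lemma vec_eq_iff_sum:
  "(x :: real^('n::finite + 'k::finite)) = y \<longleftrightarrow>
    (\<forall>a. x $ Inl a = y $ Inl a) \<and> (\<forall>b. x $ Inr b = y $ Inr b)"
  by (metis sum.exhaust vec_eq_iff)

lemma inner_stack: "stack x u \<bullet> stack y v = x \<bullet> y + u \<bullet> v"
  by (simp add: inner_vec_def sum_UNIV_Plus)

lemma hcat_stack: "hcat A B *v stack x u = A *v x + B *v u"
  by (simp add: vec_eq_iff matrix_vector_mult_def hcat_def sum_UNIV_Plus)

lemma vcat_mult: "vcat A B *v x = stack (A *v x) (B *v x)"
  by (simp add: vec_eq_iff_sum matrix_vector_mult_def vcat_def)

lemma inner_vector_matrix_mult:
  fixes A :: "real^'n::finite^'m::finite"
  shows "x \<bullet> (y v* A) = (A *v x) \<bullet> y"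
  by (metis dot_lmul_matrix inner_commute)

text \<open>The quadratic form of the matrix inequality, evaluated at
  \<open>stack x u\<close>.\<close>

lemma lmi_dissipation:
  assumes "lmi A B C D P M \<rho>"
  shows "(A *v x + B *v u) \<bullet> (P *v (A *v x + B *v u))
    + (C *v x + D *v u) \<bullet> (M *v (C *v x + D *v u)) \<le> \<rho>\<^sup>2 * (x \<bullet> (P *v x))"
proof -
  have "stack x u \<bullet> ((four_block (transpose A ** P ** A - \<rho>\<^sup>2 *\<^sub>R P) (transpose A ** P ** B)
        (transpose B ** P ** A) (transpose B ** P ** B)
      + vcat (transpose C) (transpose D) ** M ** hcat C D) *v stack x u) \<le> 0"
    using assms by (simp add: lmi_def neg_semidef_def)
  then show ?thesis
    by (simp add: four_block_def matrix_vector_mult_add_rdistrib matrix_vector_mult_diff_rdistrib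
        vcat_mult hcat_stack inner_stack inner_vector_matrix_mult inner_add_left inner_add_right
        inner_diff_right matrix_vector_right_distrib scaleR_matrix_vector_assoc[symmetric]
        flip: matrix_vector_mul_assoc)
qed

section \<open>The transformed algorithm\<close>

text \<open>The explicit inverse of \<open>T_mat\<close> for nonzero \<open>c1\<close>, from solving
  the output equation for the integrator state.\<close>

definition T_inv :: "real \<Rightarrow> real^'r::finite^1 \<Rightarrow> real^(1 + 'r)^(1 + 'r)" where
  "T_inv c1 C2 = four_block (mat (1 / c1)) (- (1 / c1) *\<^sub>R C2) 0 (mat 1)"

lemma mat_vector_mult: "mat c *v x = c *\<^sub>R (x :: real^'n::finite)"
  by (simp add: vec_eq_iff matrix_vector_mult_def mat_def if_distrib[of "\<lambda>z. z * _"] cong: if_cong)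

lemma four_block_stack:
  "four_block A B C D *v stack x u = stack (A *v x + B *v u) (C *v x + D *v u)"
  by (simp add: four_block_def vcat_mult hcat_stack)

lemma stack_exhaust:
  obtains x u where "(z :: real^('n::finite + 'k::finite)) = stack x u"
proof
  show "z = stack (\<chi> a. z $ Inl a) (\<chi> b. z $ Inr b)"
    by (simp add: vec_eq_iff_sum)
qed

lemma matrix_inv_T_mat:
  assumes "c1 \<noteq> 0"
  shows "T_inv c1 C2 ** T_mat c1 C2 = mat 1" and "matrix_inv (T_mat c1 C2) = T_inv c1 C2"
proof -
  have minus: "(- N) *v v = - (N *v v)" for N :: "real^'r^1" and v
    using matrix_vector_mult_diff_rdistrib[of 0 N v] by simp
  have "(T_inv c1 C2 ** T_mat c1 C2) *v z = mat 1 *v z" for z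
  proof -
    obtain x u where "z = stack x u"
      by (rule stack_exhaust)
    then show ?thesis
      using assms
      by (simp add: T_inv_def T_mat_def four_block_stack mat_vector_mult minus
          scaleR_matrix_vector_assoc[symmetric] scaleR_right_distrib
          flip: matrix_vector_mul_assoc)
  qed
  then show *: "T_inv c1 C2 ** T_mat c1 C2 = mat 1"
    by (simp add: matrix_eq)
  then have "T_mat c1 C2 ** T_inv c1 C2 = mat 1"
    by (simp add: matrix_left_right_inverse)
  \<comment> \<open>\<open>matrix_inv\<close> is defined by choice: existence makes it an inverse,
    and multiplication by \<open>T_inv\<close> identifies it.\<close>
  with * have "\<exists>N. T_mat c1 C2 ** N = mat 1 \<and> N ** T_mat c1 C2 = mat 1"
    by blast
  then have "T_mat c1 C2 ** matrix_inv (T_mat c1 C2) = mat 1 \<and>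
      matrix_inv (T_mat c1 C2) ** T_mat c1 C2 = mat 1"
    unfolding matrix_inv_def by (rule someI_ex)
  then have "T_inv c1 C2 ** (T_mat c1 C2 ** matrix_inv (T_mat c1 C2)) = T_inv c1 C2"
    by simp
  then show "matrix_inv (T_mat c1 C2) = T_inv c1 C2"
    by (simp add: matrix_mul_assoc *)
qed

text \<open>The first row of \<open>T\<^sup>-\<^sup>1\<close>: it recovers the integrator state \<open>\<xi>\<^sup>(\<^sup>1\<^sup>)\<close>.\<close>

definition integrator_row :: "real \<Rightarrow> real^'r::finite^1 \<Rightarrow> real^(1 + 'r)" where
  "integrator_row c1 C2 = T_inv c1 C2 $ Inl 1"

lemma inner_integrator_row: "integrator_row c1 C2 \<bullet> v = (T_inv c1 C2 *v v) $ Inl 1"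
  by (simp add: integrator_row_def matrix_vector_mult_def inner_vec_def)

text \<open>Undoing the change of coordinates leaves the original system matrix, whose first block
  row is that of an integrator.\<close>

lemma integrator_row_A_tilde:
  assumes "c1 \<noteq> 0"
  shows "integrator_row c1 C2 \<bullet> (A_tilde c1 C2 A21 A22 *v v) = integrator_row c1 C2 \<bullet> v"
proof -
  obtain x u where xu: "T_inv c1 C2 *v v = stack x u"
    by (rule stack_exhaust)
  have "T_inv c1 C2 *v (A_tilde c1 C2 A21 A22 *v v)
      = (T_inv c1 C2 ** T_mat c1 C2) *v (four_block (mat 1) 0 A21 A22 *v (T_inv c1 C2 *v v))"
    by (simp add: A_tilde_def matrix_inv_T_mat(2)[OF assms] flip: matrix_vector_mul_assoc)
  then show ?thesis
    by (simp add: inner_integrator_row matrix_inv_T_mat(1)[OF assms] xu four_block_stack)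
qed

lemma integrator_row_B_tilde:
  assumes "c1 \<noteq> 0"
  shows "integrator_row c1 C2 \<bullet> (B_tilde c1 *v v) = v $ 1"
  using assms
  by (simp add: inner_integrator_row B_tilde_def vcat_mult T_inv_def four_block_stack mat_vector_mult)

section \<open>The augmented system and the constraint on the filter\<close>

lemma C_tilde_mult: "C_tilde *v x = vec (x $ Inl 1)"
proof -
  obtain y z where "x = stack y z"
    by (rule stack_exhaust)
  then show ?thesis
    by (simp add: C_tilde_def hcat_stack)
qed

text \<open>The filter does not feed back into the algorithm; hence the integrator row padded with
  zeros stays a left fixed vector.\<close>

lemma A_hat_upper: "(\<chi> a. (A_hat At A By *v x) $ Inl a) = At *v (\<chi> a. x $ Inl a)"
proof -
  obtain y z where "x = stack y z"
    by (rule stack_exhaust)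
  then show ?thesis
    by (simp add: A_hat_def four_block_stack)
qed

lemma stack_zero_inner: "stack w 0 \<bullet> x = w \<bullet> (\<chi> a. x $ Inl a)"
  by (simp add: inner_vec_def sum_UNIV_Plus)

text \<open>
  The constraint is only needed at the horizon \<open>t = T = 0\<close>, for the quadratic \<open>m/2 |y|\<^sup>2\<close> and its
  fixed point \<open>0\<close>.
\<close>

lemma truncated_hard_iqcD:
  fixes y :: "real^'d::finite"
  assumes "truncated_hard_iqc m L A By Bu C Dy Du M" and "m \<le> L"
  shows "0 \<le> filter_map C Dy Du \<zeta> y (m *\<^sub>R y) \<bullet> (M *v filter_map C Dy Du \<zeta> y (m *\<^sub>R y))"
proof -
  \<comment> \<open>The filter trajectory from the arbitrary state \<open>\<zeta>\<close> under the
    constant input; only its value at time 0 enters the sum.\<close>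
  define z where "z = rec_nat \<zeta> (\<lambda>_ s. filter_map A By Bu s y (m *\<^sub>R y))"
  let ?h = "\<lambda>k. filter_map C Dy Du (z k) y (m *\<^sub>R y)"
  let ?f = "\<lambda>y::real^'d. m * (norm y)\<^sup>2 / 2"
  have "0 \<le> (\<Sum>k=0..0. (?h k - 0) \<bullet> (M *v (?h k - 0)))"
    by (rule assms(1)[unfolded truncated_hard_iqc_def, rule_format,
          OF half_norm_square_in_S_class[OF assms(2)],
          of "\<lambda>_. m *\<^sub>R y" "\<lambda>_. y" z ?h 0 0 0 0 0 0])
       (simp_all add: z_def grad_eqI[OF GDERIV_half_norm_square] filter_map_def single_zero)
  then show ?thesis
    by (simp add: z_def)
qed

lemma static_truncated_hard_iqcD:
  fixes y :: "real^'d::finite"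
  assumes "static_truncated_hard_iqc m L Dy Du M" and "m \<le> L"
  shows "0 \<le> static_map Dy Du y (m *\<^sub>R y) \<bullet> (M *v static_map Dy Du y (m *\<^sub>R y))"
proof -
  let ?h = "\<lambda>k::nat. static_map Dy Du y (m *\<^sub>R y)"
  have "0 \<le> (\<Sum>k=0..0. (?h k - 0) \<bullet> (M *v (?h k - 0)))"
    by (rule assms(1)[unfolded static_truncated_hard_iqc_def, rule_format,
          OF half_norm_square_in_S_class[OF assms(2)],
          of "\<lambda>_. m *\<^sub>R y" "\<lambda>_. y" ?h 0 0 0 0 0])
       (simp_all add: grad_eqI[OF GDERIV_half_norm_square] static_map_def single_zero)
  then show ?thesis
    by simp
qed

text \<open>Links the two assumptions: the output in the matrix inequality is the filter output that
  the constraint speaks of.\<close>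

lemma kronI_C_hat:
  fixes X :: "real^(((1 + 'r::finite) + 'p::finite) \<times> 'd::finite)"
  shows "kronI (C_hat C Dy) *v X + kronI Du *v single u
    = filter_map C Dy Du (unslice (\<lambda>a. \<chi> b. X $ (Inr b, a))) (block (Inl (Inl 1)) X) u"
proof (rule slice_eqI)
  fix a
  obtain y z where yz: "slice a X = stack y z"
    by (rule stack_exhaust)
  then have "y $ Inl 1 = block (Inl (Inl 1)) X $ a"
    by (simp add: block_nth)
  moreover have "z $ b = X $ (Inr b, a)" for b
    using arg_cong[OF yz, of "\<lambda>v. v $ Inr b"] by (simp add: slice_def)
  then have "z = (\<chi> b. X $ (Inr b, a))"
    by (simp add: vec_eq_iff)
  ultimately show "slice a (kronI (C_hat C Dy) *v X + kronI Du *v single u) = slice a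
      (filter_map C Dy Du (unslice (\<lambda>a. \<chi> b. X $ (Inr b, a))) (block (Inl (Inl 1)) X) u)"
    by (simp add: yz C_hat_def hcat_stack filter_map_def C_tilde_mult add_ac
        flip: matrix_vector_mul_assoc)
qed

lemma kronI_C_tilde:
  "kronI (Dy ** C_tilde) *v X + kronI Du *v single u = static_map Dy Du (block (Inl 1) X) u"
  by (rule slice_eqI)
     (simp add: static_map_def C_tilde_mult block_nth flip: matrix_vector_mul_assoc)

theorem theorem1:
  fixes f :: "real^'d::finite \<Rightarrow> real" and \<Omega> :: "(real^'d) set" and m L c1 :: real
    and C2 :: "real^'r^1" and A21 :: "real^1^'r" and A22 :: "real^'r^'r"
  assumes "0 < m" and "m \<le> L" and "f \<in> S_class m L"
    and "\<Omega> \<noteq> {}" and "closed \<Omega>" and "convex \<Omega>"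
    and "c1 < 0"
  shows
    "(\<forall>(A\<Psi> :: real^'p^'p) (By :: real^1^'p) (Bu :: real^1^'p)
        (C\<Psi> :: real^'p^'q) (Dy :: real^1^'q) (Du :: real^1^'q)
        (M :: real^('q \<times> 'd)^('q \<times> 'd)) (\<rho> :: real) (P :: real^((1 + 'r) + 'p)^((1 + 'r) + 'p)).
        schur_stable (kronI A\<Psi> :: real^('p \<times> 'd)^('p \<times> 'd)) \<and>
        transpose M = M \<and> truncated_hard_iqc m L A\<Psi> By Bu C\<Psi> Dy Du M \<and>
        0 < \<rho> \<and> \<rho> < 1 \<and>
        pos_def (kronI P :: real^(((1 + 'r) + 'p) \<times> 'd)^(((1 + 'r) + 'p) \<times> 'd)) \<and>
        lmi (kronI (A_hat (A_tilde c1 C2 A21 A22) A\<Psi> By)) (kronI (B_hat (B_tilde c1) Bu))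
            (kronI (C_hat C\<Psi> Dy)) (kronI Du) (kronI P) M \<rho>
        \<longrightarrow>
        (\<exists>us ys xs.
           projected_fixed_points f \<Omega> (Inl (Inl 1))
             (A_hat (A_tilde c1 C2 A21 A22) A\<Psi> By) (B_hat (B_tilde c1) Bu) P = {(us, ys, xs)} \<and>
           {y. is_arg_min f (\<lambda>y. y \<in> \<Omega>) y} = {ys}))
     \<and>
     (\<forall>(Dy :: real^1^'q) (Du :: real^1^'q)
        (M :: real^('q \<times> 'd)^('q \<times> 'd)) (\<rho> :: real) (P :: real^(1 + 'r)^(1 + 'r)).
        transpose M = M \<and> static_truncated_hard_iqc m L Dy Du M \<and>
        0 < \<rho> \<and> \<rho> < 1 \<and>
        pos_def (kronI P :: real^((1 + 'r) \<times> 'd)^((1 + 'r) \<times> 'd)) \<and>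
        lmi (kronI (A_tilde c1 C2 A21 A22)) (kronI (B_tilde c1))
            (kronI (Dy ** C_tilde)) (kronI Du) (kronI P) M \<rho>
        \<longrightarrow>
        (\<exists>us ys xs.
           projected_fixed_points f \<Omega> (Inl 1)
             (A_tilde c1 C2 A21 A22) (B_tilde c1) P = {(us, ys, xs)} \<and>
           {y. is_arg_min f (\<lambda>y. y \<in> \<Omega>) y} = {ys}))"
proof (intro conjI allI impI; elim conjE)
  fix A\<Psi> :: "real^'p^'p" and By Bu :: "real^1^'p" and C\<Psi> :: "real^'p^'q" and Dy Du :: "real^1^'q"
    and M :: "real^('q \<times> 'd)^('q \<times> 'd)" and \<rho> :: real and P :: "real^((1 + 'r) + 'p)^((1 + 'r) + 'p)"
  assume iqc: "truncated_hard_iqc m L A\<Psi> By Bu C\<Psi> Dy Du M"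
    and \<rho>: "0 < \<rho>" "\<rho> < 1"
    and P: "pos_def (kronI P :: real^(((1 + 'r) + 'p) \<times> 'd)^(((1 + 'r) + 'p) \<times> 'd))"
    and lmi: "lmi (kronI (A_hat (A_tilde c1 C2 A21 A22) A\<Psi> By)) (kronI (B_hat (B_tilde c1) Bu))
      (kronI (C_hat C\<Psi> Dy)) (kronI Du) (kronI P) M \<rho>"
  show "\<exists>us ys xs. projected_fixed_points f \<Omega> (Inl (Inl 1))
      (A_hat (A_tilde c1 C2 A21 A22) A\<Psi> By) (B_hat (B_tilde c1) Bu) P = {(us, ys, xs)} \<and>
    {y. is_arg_min f (\<lambda>y. y \<in> \<Omega>) y} = {ys}"
  proof (rule projected_fixed_points_unique[OF assms(1,3,4,5,6) P \<rho>,
        where w = "stack (integrator_row c1 C2) 0"])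
    fix X Z :: "real^(((1 + 'r) + 'p) \<times> 'd)"
    \<comment> \<open>The gradient of \<open>m/2 |y|\<^sup>2\<close>: for this input the constraint
      makes the \<open>M\<close>-term of the dissipation inequality nonnegative, which leaves the
      contraction.\<close>
    let ?u = "m *\<^sub>R block (Inl (Inl 1)) X"
    assume "Z = kronI (A_hat (A_tilde c1 C2 A21 A22) A\<Psi> By) *v X
      + kronI (B_hat (B_tilde c1) Bu) *v single ?u"
    then show "Z \<bullet> (kronI P *v Z) \<le> \<rho>\<^sup>2 * (X \<bullet> (kronI P *v X))"
      using lmi_dissipation[OF lmi, of X "single ?u"] truncated_hard_iqcD[OF iqc assms(2)]
      unfolding kronI_C_hat by (smt (verit))
  qed (use assms(7) in \<open>simp_all add: A_hat_upper stack_zero_inner integrator_row_A_tilde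
      integrator_row_B_tilde B_hat_def vcat_mult\<close>)
next
  fix Dy Du :: "real^1^'q" and M :: "real^('q \<times> 'd)^('q \<times> 'd)" and \<rho> :: real
    and P :: "real^(1 + 'r)^(1 + 'r)"
  assume iqc: "static_truncated_hard_iqc m L Dy Du M"
    and \<rho>: "0 < \<rho>" "\<rho> < 1"
    and P: "pos_def (kronI P :: real^((1 + 'r) \<times> 'd)^((1 + 'r) \<times> 'd))"
    and lmi: "lmi (kronI (A_tilde c1 C2 A21 A22)) (kronI (B_tilde c1))
      (kronI (Dy ** C_tilde)) (kronI Du) (kronI P) M \<rho>"
  show "\<exists>us ys xs. projected_fixed_points f \<Omega> (Inl 1)
      (A_tilde c1 C2 A21 A22) (B_tilde c1) P = {(us, ys, xs)} \<and>
    {y. is_arg_min f (\<lambda>y. y \<in> \<Omega>) y} = {ys}"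
  proof (rule projected_fixed_points_unique[OF assms(1,3,4,5,6) P \<rho>,
        where w = "integrator_row c1 C2"])
    fix X Z :: "real^((1 + 'r) \<times> 'd)"
    let ?u = "m *\<^sub>R block (Inl 1) X"
    assume "Z = kronI (A_tilde c1 C2 A21 A22) *v X + kronI (B_tilde c1) *v single ?u"
    then show "Z \<bullet> (kronI P *v Z) \<le> \<rho>\<^sup>2 * (X \<bullet> (kronI P *v X))"
      using lmi_dissipation[OF lmi, of X "single ?u"] static_truncated_hard_iqcD[OF iqc assms(2)]
      unfolding kronI_C_tilde by (smt (verit))
  qed (use assms(7) in \<open>simp_all add: integrator_row_A_tilde integrator_row_B_tilde\<close>)
qed

end
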